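(* Let $\mu>0$ and let $X$ be an integrable random variable with $X\ge 0$ a.s. and $\mathbf{E}(X)>\mu$. Let $X_1,X_2,\ldots$ be an i.i.d. sample of $X$, and for $c\in[0,1]$ and $n\ge 0$ put $M_n(c)=\prod_{i=1}^n\left((1-c)+c\,X_i/\mu\right)$. Then there is $c_{\max}\in(0,1]$ such that for every $c$ with $0<c<c_{\max}$ we have $\lim_{n\to\infty}M_n(c)=\infty$ a.s. Let moreover $\pi$ be a probability density on $[0,1]$ such that for all $0<b<1$ there is $0<a<b$ with $\int_a^b\pi(c)\,dc>0$, and put $M_n(\pi)=\int_0^1 M_n(c)\pi(c)\,dc$. Then $\lim_{n\to\infty}M_n(\pi)=\infty$ a.s., and the test of $H_0:\mathbf{E}(X)\le\mu$ based on $\{M_n(\pi)\}_n$ is consistent, i.e. it has power $1$: for every significance level $\alpha$ with $0<\alpha\le 1$, $\mathbb{P}\{\exists n\ge 0: M_n(\pi)\ge 1/\alpha\}=1$.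
   Context: The test of $H_0:\mathbf{E}(X)\le\mu$ at significance level $\alpha$ based on a process $\{M_n\}_{n\ge0}$ with $M_0=1$ rejects $H_0$ as soon as $M_n\ge 1/\alpha$ for some $n$. The power of the test is the probability that $H_0$ is rejected when $\mathbf{E}(X)>\mu$. *)

theory Defs
  imports "HOL-Probability.Probability"
begin

(* The sample lives on the space P and is indexed by 1, 2, ...  The random variable X that is
   sampled may live on another space Q: only its law matters. *)
definition iid_sample ::
  "'a measure \<Rightarrow> (nat \<Rightarrow> 'a \<Rightarrow> real) \<Rightarrow> 'b measure \<Rightarrow> ('b \<Rightarrow> real) \<Rightarrow> bool" where
  "iid_sample P Xs Q X \<longleftrightarrow>
     prob_space.indep_vars P (\<lambda>_. borel) Xs {1..} \<and>
     (\<forall>i\<ge>1. distr P borel (Xs i) = distr Q borel X)"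

definition wealth :: "real \<Rightarrow> (nat \<Rightarrow> 'a \<Rightarrow> real) \<Rightarrow> real \<Rightarrow> nat \<Rightarrow> 'a \<Rightarrow> real" where
  "wealth \<mu> Xs c n \<omega> = (\<Prod>i=1..n. (1 - c) + c * Xs i \<omega> / \<mu>)"

(* For fixed n and \<omega> the integrand is a polynomial in c times the density, so the
   integral exists whenever the density is integrable over the unit interval. *)
definition mixed_wealth ::
  "real \<Rightarrow> (nat \<Rightarrow> 'a \<Rightarrow> real) \<Rightarrow> (real \<Rightarrow> real) \<Rightarrow> nat \<Rightarrow> 'a \<Rightarrow> real" where
  "mixed_wealth \<mu> Xs \<pi> n \<omega> = (LBINT c:{0..1}. wealth \<mu> Xs c n \<omega> * \<pi> c)"

(* Values of the density outside the unit interval are irrelevant. *)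
definition unit_interval_density :: "(real \<Rightarrow> real) \<Rightarrow> bool" where
  "unit_interval_density \<pi> \<longleftrightarrow>
     (\<forall>c\<in>{0..1}. 0 \<le> \<pi> c) \<and> set_integrable lborel {0..1} \<pi> \<and> (LBINT c:{0..1}. \<pi> c) = 1"

definition rejection_event :: "'a measure \<Rightarrow> (nat \<Rightarrow> 'a \<Rightarrow> real) \<Rightarrow> real \<Rightarrow> 'a set" where
  "rejection_event P M \<alpha> = {\<omega> \<in> space P. \<exists>n. M n \<omega> \<ge> 1 / \<alpha>}"

(* This is the power when the law of the sample under P violates the null hypothesis. *)
definition test_power :: "'a measure \<Rightarrow> (nat \<Rightarrow> 'a \<Rightarrow> real) \<Rightarrow> real \<Rightarrow> real" where
  "test_power P M \<alpha> = measure P (rejection_event P M \<alpha>)"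

end

theory Submission
  imports Defs "HOL-Real_Asymp.Real_Asymp"
begin

text \<open>
  For small \<open>c\<close> the reciprocal of a factor \<open>1 + c Y\<close>, \<open>Y = X / \<mu> - 1\<close>, has expectation
  \<open>1 - c E(Y) + O(c\<^sup>2) < 1\<close> (after truncating \<open>Y\<close> from above), so the expected reciprocals of
  the wealth decay geometrically. They are summable, whence the reciprocal wealth tends to \<open>0\<close>
  almost surely; neither logarithms nor a law of large numbers are needed. For the mixture, the
  logarithm of the wealth is concave in \<open>c\<close> and vanishes at \<open>c = 0\<close>, so for \<open>a \<le> c \<le> b\<close> the wealth
  at \<open>c\<close> is at least the wealth at \<open>b\<close> to the power \<open>a / b\<close> once the latter exceeds \<open>1\<close>.
\<close>

section \<open>Weighted means\<close>

text \<open>The weighted AM-GM inequality for 1 and \<open>y\<close>, obtained from concavity of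
  \<open>ln\<close>. It will compare single factors of the wealth at two values of
  \<open>c\<close>.\<close>

lemma powr_le_affine:
  fixes y t :: real
  assumes "0 < y" "0 \<le> t" "t \<le> 1"
  shows "y powr t \<le> 1 - t + t * y"
proof -
  have "t * ln y \<le> ln (1 - t + t * y)"
    using concave_onD[OF ln_concave, of t 1 y] assms by simp
  moreover have "0 < 1 - t + t * y"
    using assms by (cases "t = 1") (auto intro: add_pos_nonneg)
  ultimately show ?thesis
    using assms by (simp add: powr_def ln_ge_iff)
qed

section \<open>Expected reciprocals of one factor\<close>

text \<open>Dominated convergence as the truncation level grows. Since \<open>Y\<close> is only
  integrable, its square may have infinite expectation; truncation makes a second-order estimate
  possible.\<close>

lemma (in prob_space) exists_truncation_expectation_pos:
  fixes Y :: "'a \<Rightarrow> real"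
  assumes Y: "integrable M Y" and pos: "0 < expectation Y"
  shows "\<exists>K\<ge>1. 0 < expectation (\<lambda>\<omega>. min (Y \<omega>) K)"
proof -
  note [measurable] = borel_measurable_integrable[OF Y]
  have "(\<lambda>n. expectation (\<lambda>\<omega>. min (Y \<omega>) (real n))) \<longlonglongrightarrow> expectation Y"
  proof (rule integral_dominated_convergence[where w = "\<lambda>\<omega>. \<bar>Y \<omega>\<bar>"])
    show "integrable M (\<lambda>\<omega>. \<bar>Y \<omega>\<bar>)" using Y by simp
    show "AE \<omega> in M. (\<lambda>n. min (Y \<omega>) (real n)) \<longlonglongrightarrow> Y \<omega>"
    proof (rule AE_I2)
      fix \<omega>
      have "\<forall>\<^sub>F n in sequentially. min (Y \<omega>) (real n) = Y \<omega>"
        using eventually_ge_at_top[of "nat \<lceil>Y \<omega>\<rceil>"] by eventually_elim linarith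
      then show "(\<lambda>n. min (Y \<omega>) (real n)) \<longlonglongrightarrow> Y \<omega>"
        by (rule tendsto_eventually)
    qed
  qed auto
  from order_tendstoD(1)[OF this pos]
  obtain N where "\<forall>n\<ge>N. 0 < expectation (\<lambda>\<omega>. min (Y \<omega>) (real n))"
    by (auto simp: eventually_sequentially)
  \<comment> \<open>The maximum with 1 secures \<open>1 \<le> K\<close>, so that later
    \<open>-1 \<le> z \<le> K\<close> gives \<open>\<bar>z\<bar> \<le> K\<close>.\<close>
  then show ?thesis by (intro exI[of _ "real (max 1 N)"]) auto
qed

text \<open>Expanding the reciprocal to second order, the linear term lowers the expectation by a
  positive multiple of \<open>c\<close>, while the remainder is of order \<open>c\<^sup>2\<close>;
  the linear term wins for small \<open>c\<close>.\<close>

lemma (in prob_space) exists_expectation_reciprocal_less_1: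
  fixes Y :: "'a \<Rightarrow> real"
  assumes Y: "integrable M Y" and ge: "AE \<omega> in M. -1 \<le> Y \<omega>" and pos: "0 < expectation Y"
  shows "\<exists>c0\<in>{0<..1}. \<forall>c. 0 < c \<and> c < c0 \<longrightarrow> (\<integral>\<^sup>+\<omega>. ennreal (1 / (1 + c * Y \<omega>)) \<partial>M) < 1"
proof -
  obtain K where K: "1 \<le> K" and d: "0 < expectation (\<lambda>\<omega>. min (Y \<omega>) K)"
    using exists_truncation_expectation_pos[OF Y pos] by blast
  define d where "d = expectation (\<lambda>\<omega>. min (Y \<omega>) K)"
  \<comment> \<open>The bound 1/2 keeps \<open>1 + c * z\<close> at least 1/2 for
    \<open>z \<ge> -1\<close>. At \<open>c = d / (2 * K\<^sup>2)\<close> the linear gain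
    \<open>c * d\<close> equals the quadratic loss \<open>2 * c\<^sup>2 * K\<^sup>2\<close>.\<close>
  define c0 where "c0 = min (1/2) (d / (2 * K\<^sup>2))"
  have c0: "c0 \<in> {0<..1}" using d K by (auto simp: c0_def d_def)
  have int: "integrable M (\<lambda>\<omega>. min (Y \<omega>) K)" using Y by simp
  have "(\<integral>\<^sup>+\<omega>. ennreal (1 / (1 + c * Y \<omega>)) \<partial>M) < 1" if c: "0 < c" "c < c0" for c
  proof -
    have c_half: "c \<le> 1/2" and c_small: "c * (2 * K\<^sup>2) < d"
      using c K by (auto simp: c0_def pos_less_divide_eq)
    define B where "B \<omega> = 1 - c * min (Y \<omega>) K + 2 * c\<^sup>2 * K\<^sup>2" for \<omega>
    have B: "1 / (1 + c * Y \<omega>) \<le> B \<omega> \<and> 0 \<le> B \<omega>" if "-1 \<le> Y \<omega>" for \<omega>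
    proof -
      define z where "z = min (Y \<omega>) K"
      have z: "-1 \<le> z" "z \<le> K" "z \<le> Y \<omega>" using that K by (auto simp: z_def)
      have "c * (-1) \<le> c * z" using z c by (intro mult_left_mono) auto
      then have half: "1/2 \<le> 1 + c * z" using c_half by linarith
      have zY: "1 + c * z \<le> 1 + c * Y \<omega>" using z c by (simp add: mult_left_mono)
      have "z\<^sup>2 \<le> K\<^sup>2" using z K by (intro power2_le_iff_abs_le[THEN iffD2]) auto
      then have cz: "(c * z)\<^sup>2 \<le> c\<^sup>2 * K\<^sup>2" by (simp add: power_mult_distrib mult_left_mono)
      have "1 / (1 + c * Y \<omega>) \<le> 1 / (1 + c * z)" using zY half by (intro divide_left_mono) auto
      \<comment> \<open>The geometric series of \<open>1 / (1 + c * z)\<close> with its exact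
        remainder after two terms.\<close>
      also have "\<dots> = 1 - c * z + (c * z)\<^sup>2 / (1 + c * z)"
        using half by (simp add: field_simps power2_eq_square)
      also have "(c * z)\<^sup>2 / (1 + c * z) \<le> (c * z)\<^sup>2 / (1/2)"
        using half by (intro divide_left_mono) auto
      also have "1 - c * z + (c * z)\<^sup>2 / (1/2) \<le> B \<omega>"
        using cz by (simp add: B_def z_def)
      finally have "1 / (1 + c * Y \<omega>) \<le> B \<omega>" by simp
      moreover have "0 \<le> 1 / (1 + c * Y \<omega>)" using zY half by simp
      ultimately show ?thesis by linarith
    qed
    have intB: "integrable M B" unfolding B_def using int by simp
    have "expectation B = 1 - c * d + 2 * c\<^sup>2 * K\<^sup>2"
      unfolding B_def d_def using int by (simp add: prob_space)
    also have "\<dots> = 1 - c * (d - c * (2 * K\<^sup>2))" by (simp add: algebra_simps power2_eq_square)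
    also have "\<dots> < 1" using c c_small by simp
    finally have "expectation B < 1" .
    have "(\<integral>\<^sup>+\<omega>. ennreal (1 / (1 + c * Y \<omega>)) \<partial>M) \<le> (\<integral>\<^sup>+\<omega>. ennreal (B \<omega>) \<partial>M)"
      using ge B by (intro nn_integral_mono_AE) (auto intro: ennreal_leI)
    also have "\<dots> = ennreal (expectation B)"
      using ge B by (intro nn_integral_eq_integral intB) auto
    also have "\<dots> < 1" using \<open>expectation B < 1\<close> by (simp add: ennreal_less_one_iff)
    finally show ?thesis .
  qed
  with c0 show ?thesis by blast
qed

section \<open>Products of independent factors\<close>

text \<open>By independence the expected reciprocal of the product of \<open>n\<close> factors is at
  most the \<open>n\<close>-th power of \<open>r\<close>. The sum of these reciprocals thus has
  finite expectation, so it converges almost surely and its terms tend to 0.\<close>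

lemma (in prob_space) AE_prod_at_top:
  fixes Z :: "nat \<Rightarrow> 'a \<Rightarrow> real"
  assumes indep: "indep_vars (\<lambda>_. borel) Z {1..}"
    and pos: "AE \<omega> in M. \<forall>i\<ge>1. 0 < Z i \<omega>"
    and le: "\<And>i. 1 \<le> i \<Longrightarrow> (\<integral>\<^sup>+\<omega>. ennreal (1 / Z i \<omega>) \<partial>M) \<le> r"
    and "r < 1"
  shows "AE \<omega> in M. filterlim (\<lambda>n. \<Prod>i=1..n. Z i \<omega>) at_top sequentially"
proof -
  obtain q where q: "r = ennreal q" "0 \<le> q" "q < 1"
    using \<open>r < 1\<close> by (cases r) (auto simp: ennreal_less_one_iff)
  \<comment> \<open>With values in \<open>ennreal\<close>, both the product formula for expectations
    and the exchange of sum and integral hold without integrability conditions.\<close>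
  define V where "V n \<omega> = (\<Prod>i=1..n. ennreal (1 / Z i \<omega>))" for n \<omega>
  have [measurable]: "Z i \<in> borel_measurable M" if "1 \<le> i" for i
    using indep that by (auto simp: indep_vars_def)
  have [measurable]: "V n \<in> borel_measurable M" for n
    unfolding V_def by (intro borel_measurable_prod_ennreal) simp
  have V_le: "(\<integral>\<^sup>+\<omega>. V n \<omega> \<partial>M) \<le> ennreal (q ^ n)" for n
  proof -
    have ind: "indep_vars (\<lambda>_. borel) (\<lambda>i \<omega>. ennreal (1 / Z i \<omega>)) {1..n}"
      by (rule indep_vars_compose2[OF indep_vars_subset[OF indep]]) auto
    have "(\<integral>\<^sup>+\<omega>. V n \<omega> \<partial>M) = (\<Prod>i=1..n. \<integral>\<^sup>+\<omega>. ennreal (1 / Z i \<omega>) \<partial>M)"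
      unfolding V_def using ind by (intro indep_vars_nn_integral) auto
    also have "\<dots> \<le> (\<Prod>i=1..n. ennreal q)"
      using le q(1) by (intro prod_mono_ennreal) auto
    finally show ?thesis using q by (simp add: ennreal_power)
  qed
  have "(\<integral>\<^sup>+\<omega>. (\<Sum>n. V n \<omega>) \<partial>M) = (\<Sum>n. \<integral>\<^sup>+\<omega>. V n \<omega> \<partial>M)"
    by (rule nn_integral_suminf) simp
  also have "\<dots> \<le> (\<Sum>n. ennreal (q ^ n))"
    by (intro suminf_le V_le) auto
  also have "\<dots> < \<top>"
    using q by (simp add: less_top ennreal_suminf_neq_top summable_geometric)
  finally have "(\<integral>\<^sup>+\<omega>. (\<Sum>n. V n \<omega>) \<partial>M) \<noteq> \<infinity>"
    by simp
  then have "AE \<omega> in M. (\<Sum>n. V n \<omega>) \<noteq> \<infinity>"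
    by (intro nn_integral_PInf_AE) auto
  with pos show ?thesis
  proof eventually_elim
    case (elim \<omega>)
    define W where "W n = (\<Prod>i=1..n. Z i \<omega>)" for n
    have W: "0 < W n" for n unfolding W_def using elim by (intro prod_pos) auto
    have "V n \<omega> = ennreal (inverse (W n))" for n
      unfolding V_def W_def using elim
      by (subst prod_ennreal) (auto simp: prod_dividef inverse_eq_divide less_imp_le)
    with elim have "(\<Sum>n. ennreal (inverse (W n))) \<noteq> top" by simp
    then have "summable (\<lambda>n. inverse (W n))"
      by (intro summable_suminf_not_top) (auto simp: W less_imp_le)
    then have "(\<lambda>n. inverse (W n)) \<longlonglongrightarrow> 0" by (rule summable_LIMSEQ_zero)
    \<comment> \<open>Positivity of \<open>W\<close> makes its reciprocals approach 0 from above,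
      which fixes the sign of the infinite limit.\<close>
    then have "filterlim (\<lambda>n. inverse (inverse (W n))) at_top sequentially"
      by (rule filterlim_inverse_at_top) (simp add: W)
    then show ?case by (simp add: W_def)
  qed
qed

section \<open>Wealth at a fixed c\<close>

text \<open>Almost sure nonnegativity depends only on the law, so it passes from \<open>X\<close> to
  each \<open>Xs i\<close>; countably many indices share one null set.\<close>

lemma iid_sample_nonneg:
  assumes "iid_sample P Xs Q X" and "X \<in> borel_measurable Q" and "AE \<omega> in Q. 0 \<le> X \<omega>"
    and P: "prob_space P"
  shows "AE \<omega> in P. \<forall>i\<ge>1. 0 \<le> Xs i \<omega>"
proof -
  interpret prob_space P by fact
  have "AE \<omega> in P. 0 \<le> Xs i \<omega>" if "1 \<le> i" for i
  proof -
    have [measurable]: "Xs i \<in> borel_measurable P"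
      using assms(1) that by (auto simp: iid_sample_def indep_vars_def)
    have "AE x in distr Q borel X. 0 \<le> x"
      using assms by (subst AE_distr_iff) auto
    also have "distr Q borel X = distr P borel (Xs i)"
      using assms(1) that unfolding iid_sample_def by metis
    finally have "AE x in distr P borel (Xs i). 0 \<le> x" .
    then show ?thesis by (subst (asm) AE_distr_iff) auto
  qed
  then show ?thesis by (simp add: AE_all_countable)
qed

text \<open>With \<open>Y = X / \<mu> - 1\<close> a factor has the law of \<open>1 + c * Y\<close>,
  where \<open>Y \<ge> -1\<close> almost surely and \<open>Y\<close> has positive mean. The two
  preceding probabilistic estimates then combine.\<close>

lemma exists_wealth_at_top:
  assumes "0 < \<mu>" and Q: "prob_space Q" and X: "integrable Q X" and nn: "AE \<omega> in Q. 0 \<le> X \<omega>"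
    and gt: "\<mu> < prob_space.expectation Q X"
    and P: "prob_space P" and iid: "iid_sample P Xs Q X"
  shows "\<exists>c_max\<in>{0<..1}. \<forall>c. 0 < c \<and> c < c_max \<longrightarrow>
            (AE \<omega> in P. filterlim (\<lambda>n. wealth \<mu> Xs c n \<omega>) at_top sequentially)"
proof -
  interpret Q: prob_space Q by fact
  interpret P: prob_space P by fact
  note [measurable] = borel_measurable_integrable[OF X]
  define Y where "Y \<omega> = X \<omega> / \<mu> - 1" for \<omega>
  have "integrable Q Y" unfolding Y_def using X by simp
  moreover have "AE \<omega> in Q. -1 \<le> Y \<omega>"
    using nn by eventually_elim (use \<open>0 < \<mu>\<close> in \<open>simp add: Y_def\<close>)
  moreover have "0 < Q.expectation Y"
    unfolding Y_def using X gt \<open>0 < \<mu>\<close> by (simp add: Q.prob_space)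
  ultimately obtain c0 where c0: "c0 \<in> {0<..1}" and
    less: "\<And>c. 0 < c \<Longrightarrow> c < c0 \<Longrightarrow> (\<integral>\<^sup>+\<omega>. ennreal (1 / (1 + c * Y \<omega>)) \<partial>Q) < 1"
    using Q.exists_expectation_reciprocal_less_1 by meson
  have "AE \<omega> in P. filterlim (\<lambda>n. wealth \<mu> Xs c n \<omega>) at_top sequentially"
    if c: "0 < c" "c < c0" for c
    unfolding wealth_def
  proof (rule P.AE_prod_at_top)
    show "P.indep_vars (\<lambda>_. borel) (\<lambda>i \<omega>. 1 - c + c * Xs i \<omega> / \<mu>) {1..}"
      using iid unfolding iid_sample_def
      by (intro P.indep_vars_compose2[where Y = "\<lambda>_ x. 1 - c + c * x / \<mu>" and M' = "\<lambda>_. borel"]) auto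
    \<comment> \<open>Since \<open>c < c0 \<le> 1\<close>, the summand \<open>1 - c\<close> is
      positive, and the factor stays positive even where \<open>Xs i\<close> vanishes.\<close>
    show "AE \<omega> in P. \<forall>i\<ge>1. 0 < 1 - c + c * Xs i \<omega> / \<mu>"
      using iid_sample_nonneg[OF iid borel_measurable_integrable[OF X] nn P]
    proof eventually_elim
      case (elim \<omega>)
      then show ?case using c c0 \<open>0 < \<mu>\<close> by (auto intro!: add_pos_nonneg)
    qed
    show "(\<integral>\<^sup>+\<omega>. ennreal (1 / (1 + c * Y \<omega>)) \<partial>Q) < 1" using less c by blast
    fix i :: nat assume i: "1 \<le> i"
    let ?f = "\<lambda>x. ennreal (1 / (1 - c + c * x / \<mu>))"
    have [measurable]: "Xs i \<in> borel_measurable P"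
      using iid i by (auto simp: iid_sample_def P.indep_vars_def)
    \<comment> \<open>The expected reciprocal is carried from \<open>P\<close> to \<open>Q\<close>
      through the common law on the real line.\<close>
    have "(\<integral>\<^sup>+\<omega>. ?f (Xs i \<omega>) \<partial>P) = (\<integral>\<^sup>+x. ?f x \<partial>distr P borel (Xs i))"
      by (subst nn_integral_distr) auto
    also have "distr P borel (Xs i) = distr Q borel X"
      using iid i by (simp add: iid_sample_def)
    also have "(\<integral>\<^sup>+x. ?f x \<partial>distr Q borel X) = (\<integral>\<^sup>+\<omega>. ?f (X \<omega>) \<partial>Q)"
      by (subst nn_integral_distr) auto
    also have "\<dots> = (\<integral>\<^sup>+\<omega>. ennreal (1 / (1 + c * Y \<omega>)) \<partial>Q)"
      by (simp add: Y_def algebra_simps)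
    finally show "(\<integral>\<^sup>+\<omega>. ?f (Xs i \<omega>) \<partial>P) \<le> (\<integral>\<^sup>+\<omega>. ennreal (1 / (1 + c * Y \<omega>)) \<partial>Q)"
      by simp
  qed
  with c0 show ?thesis by blast
qed

section \<open>The mixture over c\<close>

lemma wealth_nonneg:
  assumes "0 < \<mu>" "0 \<le> c" "c \<le> 1" "\<forall>i\<ge>1. 0 \<le> Xs i \<omega>"
  shows "0 \<le> wealth \<mu> Xs c n \<omega>"
  unfolding wealth_def using assms by (intro prod_nonneg) auto

text \<open>The factor at \<open>c\<close> is the convex combination of 1 and the factor at
  \<open>b\<close> with weight \<open>c / b\<close> on the latter, so \<open>powr_le_affine\<close>
  applies factor by factor. The condition \<open>b < 1\<close> makes the factors at \<open>b\<close>
  positive.\<close>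

lemma wealth_ge_powr:
  assumes "0 < \<mu>" and b: "0 < b" "b < 1" and c: "0 \<le> c" "c \<le> b" and nn: "\<forall>i\<ge>1. 0 \<le> Xs i \<omega>"
  shows "wealth \<mu> Xs b n \<omega> powr (c / b) \<le> wealth \<mu> Xs c n \<omega>"
proof -
  define y where "y i = 1 - b + b * Xs i \<omega> / \<mu>" for i
  have y: "0 < y i" if "1 \<le> i" for i
    unfolding y_def using that assms by (auto intro!: add_pos_nonneg)
  have "wealth \<mu> Xs b n \<omega> powr (c / b) = (\<Prod>i=1..n. y i powr (c / b))"
    unfolding wealth_def y_def[symmetric] by (rule prod_powr_distrib)
  also have "\<dots> \<le> (\<Prod>i=1..n. 1 - c / b + c / b * y i)"
    using y b c by (intro prod_mono conjI powr_le_affine) auto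
  also have "\<dots> = wealth \<mu> Xs c n \<omega>"
    unfolding wealth_def y_def using b \<open>0 < \<mu>\<close> by (intro prod.cong) (auto simp: field_simps)
  finally show ?thesis .
qed

text \<open>The wealth is a polynomial in \<open>c\<close>, hence bounded on the unit interval, and
  a multiple of the density dominates. Integrability matters because the integral of a
  non-integrable function is 0 by default, which would spoil lower bounds.\<close>

lemma set_integrable_wealth_mult:
  assumes "set_integrable lborel {0..1} \<pi>"
  shows "set_integrable lborel {0..1} (\<lambda>c. wealth \<mu> Xs c n \<omega> * \<pi> c)"
proof -
  have cont: "continuous_on {0..1} (\<lambda>c. wealth \<mu> Xs c n \<omega>)"
    \<comment> \<open>Division by \<open>\<mu>\<close> becomes multiplication by a constant, so
      continuity raises no question whether \<open>\<mu>\<close> is nonzero.\<close>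
    unfolding wealth_def by (simp add: field_class.field_divide_inverse) (intro continuous_intros)
  then obtain B where B: "\<forall>c\<in>{0..1}. norm (wealth \<mu> Xs c n \<omega>) \<le> B"
    using compact_continuous_image[OF cont compact_Icc] by (auto simp: bounded_iff dest!: compact_imp_bounded)
  have [measurable]: "(\<lambda>c. wealth \<mu> Xs c n \<omega>) \<in> borel_measurable borel"
    unfolding wealth_def by measurable
  note [measurable] = borel_measurable_integrable[OF assms[unfolded set_integrable_def]]
  \<comment> \<open>The indicator moves onto \<open>\<pi>\<close>, since measurability is known only
    for the density cut off outside the unit interval.\<close>
  have eq: "(\<lambda>c. indicator {0..1} c *\<^sub>R (wealth \<mu> Xs c n \<omega> * \<pi> c))
     = (\<lambda>c. wealth \<mu> Xs c n \<omega> * (indicator {0..1} c *\<^sub>R \<pi> c))" by (auto simp: fun_eq_iff)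
  show ?thesis
    unfolding set_integrable_def
  proof (rule Bochner_Integration.integrable_bound)
    show "integrable lborel (\<lambda>c. B * (indicator {0..1} c *\<^sub>R \<pi> c))"
      using assms unfolding set_integrable_def by simp
    show "(\<lambda>c. indicator {0..1} c *\<^sub>R (wealth \<mu> Xs c n \<omega> * \<pi> c)) \<in> borel_measurable lborel"
      unfolding eq by measurable
    show "AE c in lborel. norm (indicator {0..1} c *\<^sub>R (wealth \<mu> Xs c n \<omega> * \<pi> c))
        \<le> norm (B * (indicator {0..1} c *\<^sub>R \<pi> c))"
    proof (rule AE_I2)
      fix c :: real
      show "norm (indicator {0..1} c *\<^sub>R (wealth \<mu> Xs c n \<omega> * \<pi> c))
        \<le> norm (B * (indicator {0..1} c *\<^sub>R \<pi> c))"
        using B[rule_format, of c] by (auto simp: indicator_def abs_mult intro!: mult_right_mono)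
    qed
  qed
qed

text \<open>The nonnegative integrand may be dropped outside \<open>{a..b}\<close>. Inside,
  \<open>wealth_ge_powr\<close> bounds it below by a power with exponent \<open>c / b\<close>, and
  as the base is at least 1 the exponent may be lowered to \<open>a / b\<close>.\<close>

lemma mixed_wealth_ge:
  assumes "0 < \<mu>" and ab: "0 < a" "a < b" "b < 1" and nn: "\<forall>i\<ge>1. 0 \<le> Xs i \<omega>"
    and \<pi>: "unit_interval_density \<pi>" and W: "1 \<le> wealth \<mu> Xs b n \<omega>"
  shows "wealth \<mu> Xs b n \<omega> powr (a / b) * (LBINT c:{a..b}. \<pi> c) \<le> mixed_wealth \<mu> Xs \<pi> n \<omega>"
proof -
  let ?W = "\<lambda>c. wealth \<mu> Xs c n \<omega>"
  have int: "set_integrable lborel {0..1} \<pi>" and nn_\<pi>: "\<And>c. c \<in> {0..1} \<Longrightarrow> 0 \<le> \<pi> c"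
    using \<pi> by (auto simp: unit_interval_density_def)
  have sub: "{a..b} \<subseteq> {0..1}" using ab by auto
  have intab: "set_integrable lborel {a..b} \<pi>"
    by (rule set_integrable_subset[OF int _ sub]) simp
  have intW: "set_integrable lborel {0..1} (\<lambda>c. ?W c * \<pi> c)"
    by (rule set_integrable_wealth_mult[OF int])
  have "?W b powr (a / b) * (LBINT c:{a..b}. \<pi> c) = (LBINT c:{a..b}. ?W b powr (a / b) * \<pi> c)"
    by simp
  also have "\<dots> \<le> (LBINT c:{0..1}. ?W c * \<pi> c)"
    unfolding set_lebesgue_integral_def
  proof (rule integral_mono)
    show "integrable lborel (\<lambda>c. indicator {a..b} c *\<^sub>R (?W b powr (a / b) * \<pi> c))"
      using set_integrable_mult_right[OF intab, of "?W b powr (a / b)"]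
      by (simp add: set_integrable_def)
    show "integrable lborel (\<lambda>c. indicator {0..1} c *\<^sub>R (?W c * \<pi> c))"
      using intW by (simp add: set_integrable_def)
    fix c :: real
    show "indicator {a..b} c *\<^sub>R (?W b powr (a / b) * \<pi> c) \<le> indicator {0..1} c *\<^sub>R (?W c * \<pi> c)"
    proof (cases "c \<in> {a..b}")
      case True
      then have "?W b powr (a / b) \<le> ?W b powr (c / b)"
        using W ab by (intro powr_mono divide_right_mono) auto
      also have "\<dots> \<le> ?W c" using True ab by (intro wealth_ge_powr assms) auto
      finally show ?thesis
        using True sub nn_\<pi>[of c] by (auto intro!: mult_right_mono)
    next
      case False
      then show ?thesis
        using nn_\<pi>[of c] wealth_nonneg[where Xs = Xs, OF \<open>0 < \<mu>\<close> _ _ nn] by (auto simp: indicator_def)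
    qed
  qed
  finally show ?thesis by (simp add: mixed_wealth_def)
qed

text \<open>As \<open>a > 0\<close>, the exponent \<open>a / b\<close> is positive and the lower
  bound of \<open>mixed_wealth_ge\<close> diverges with the wealth at \<open>b\<close>; that bound
  is available once this wealth has reached 1.\<close>

lemma mixed_wealth_at_top:
  assumes "0 < \<mu>" and ab: "0 < a" "a < b" "b < 1" and nn: "\<forall>i\<ge>1. 0 \<le> Xs i \<omega>"
    and \<pi>: "unit_interval_density \<pi>" and pos: "0 < (LBINT c:{a..b}. \<pi> c)"
    and lim: "filterlim (\<lambda>n. wealth \<mu> Xs b n \<omega>) at_top sequentially"
  shows "filterlim (\<lambda>n. mixed_wealth \<mu> Xs \<pi> n \<omega>) at_top sequentially"
proof (rule filterlim_at_top_mono)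
  have "filterlim (\<lambda>x. x powr (a / b)) at_top at_top"
    using ab by real_asymp
  from filterlim_compose[OF this lim]
  show "filterlim (\<lambda>n. wealth \<mu> Xs b n \<omega> powr (a / b) * (LBINT c:{a..b}. \<pi> c)) at_top sequentially"
    by (intro filterlim_at_top_mult_tendsto_pos[OF tendsto_const pos])
  have "\<forall>\<^sub>F n in sequentially. 1 \<le> wealth \<mu> Xs b n \<omega>"
    using lim by (auto simp: filterlim_at_top)
  then show "\<forall>\<^sub>F n in sequentially. wealth \<mu> Xs b n \<omega> powr (a / b) * (LBINT c:{a..b}. \<pi> c)
      \<le> mixed_wealth \<mu> Xs \<pi> n \<omega>"
    by eventually_elim (intro mixed_wealth_ge assms)
qed

text \<open>The wealth is jointly measurable in the sample point and \<open>c\<close>, so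
  integrating out \<open>c\<close> leaves a measurable function. This makes the rejection event
  measurable.\<close>

lemma borel_measurable_mixed_wealth:
  assumes Xs: "\<And>i. 1 \<le> i \<Longrightarrow> Xs i \<in> borel_measurable P"
    and \<pi>: "set_integrable lborel {0..1} \<pi>"
  shows "mixed_wealth \<mu> Xs \<pi> n \<in> borel_measurable P"
proof -
  note [measurable] = borel_measurable_integrable[OF \<pi>[unfolded set_integrable_def]]
  have [measurable]: "(\<lambda>(\<omega>, c). wealth \<mu> Xs c n \<omega>) \<in> borel_measurable (P \<Otimes>\<^sub>M lborel)"
    unfolding wealth_def case_prod_beta
  proof (intro borel_measurable_prod)
    fix i assume "i \<in> {1..n}"
    then have [measurable]: "Xs i \<in> borel_measurable P" using Xs by simp
    show "(\<lambda>x. 1 - snd x + snd x * Xs i (fst x) / \<mu>) \<in> borel_measurable (P \<Otimes>\<^sub>M lborel)"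
      by measurable
  qed
  have "mixed_wealth \<mu> Xs \<pi> n =
      (\<lambda>\<omega>. \<integral>c. wealth \<mu> Xs c n \<omega> * (indicator {0..1} c *\<^sub>R \<pi> c) \<partial>lborel)"
    unfolding mixed_wealth_def set_lebesgue_integral_def by (auto simp: fun_eq_iff ac_simps)
  also have "\<dots> \<in> borel_measurable P"
    by measurable
  finally show ?thesis .
qed

section \<open>Power of the test\<close>

text \<open>A path that diverges passes every fixed level, in particular
  \<open>1 / \<alpha>\<close>; measurability turns this almost sure statement into probability
  1.\<close>

lemma (in prob_space) test_power_eq_1:
  assumes [measurable]: "\<And>n. V n \<in> borel_measurable M"
    and lim: "AE \<omega> in M. filterlim (\<lambda>n. V n \<omega>) at_top sequentially"
  shows "test_power M V \<alpha> = 1"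
proof -
  have "AE \<omega> in M. \<exists>n. 1 / \<alpha> \<le> V n \<omega>"
    using lim
  proof eventually_elim
    case (elim \<omega>)
    then have "\<forall>\<^sub>F n in sequentially. 1 / \<alpha> \<le> V n \<omega>" by (auto simp: filterlim_at_top)
    then show ?case by (auto simp: eventually_sequentially)
  qed
  then show ?thesis
    unfolding test_power_def rejection_event_def by (subst prob_Collect_eq_1) auto
qed

theorem theorem5:
  fixes \<mu> :: real
    and Q :: "'b measure" and X :: "'b \<Rightarrow> real"
    and P :: "'a measure" and Xs :: "nat \<Rightarrow> 'a \<Rightarrow> real"
  assumes "\<mu> > 0"
    and "prob_space Q"
    and "integrable Q X"
    and "AE \<omega> in Q. X \<omega> \<ge> 0"
    and "prob_space.expectation Q X > \<mu>"
    and "prob_space P"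
    and "iid_sample P Xs Q X"
  shows "(\<exists>c_max\<in>{0<..1}. \<forall>c. 0 < c \<and> c < c_max \<longrightarrow>
            (AE \<omega> in P. filterlim (\<lambda>n. wealth \<mu> Xs c n \<omega>) at_top sequentially)) \<and>
         (\<forall>\<pi>. unit_interval_density \<pi> \<and>
            (\<forall>b. 0 < b \<and> b < 1 \<longrightarrow> (\<exists>a. 0 < a \<and> a < b \<and> (LBINT c:{a..b}. \<pi> c) > 0)) \<longrightarrow>
            (AE \<omega> in P. filterlim (\<lambda>n. mixed_wealth \<mu> Xs \<pi> n \<omega>) at_top sequentially) \<and>
            (\<forall>\<alpha>. 0 < \<alpha> \<and> \<alpha> \<le> 1 \<longrightarrow>
               test_power P (mixed_wealth \<mu> Xs \<pi>) \<alpha> = 1))"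
proof (intro conjI allI impI)
  show wealth: "\<exists>c_max\<in>{0<..1}. \<forall>c. 0 < c \<and> c < c_max \<longrightarrow>
            (AE \<omega> in P. filterlim (\<lambda>n. wealth \<mu> Xs c n \<omega>) at_top sequentially)"
    using assms by (intro exists_wealth_at_top)
  fix \<pi>
  assume "unit_interval_density \<pi> \<and>
    (\<forall>b. 0 < b \<and> b < 1 \<longrightarrow> (\<exists>a. 0 < a \<and> a < b \<and> (LBINT c:{a..b}. \<pi> c) > 0))"
  then have \<pi>: "unit_interval_density \<pi>"
    and near_0: "\<And>b. 0 < b \<Longrightarrow> b < 1 \<Longrightarrow> \<exists>a. 0 < a \<and> a < b \<and> (LBINT c:{a..b}. \<pi> c) > 0"
    by auto
  obtain c_max where c_max: "c_max \<in> {0<..1}" and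
    lim: "\<And>c. 0 < c \<Longrightarrow> c < c_max \<Longrightarrow>
      AE \<omega> in P. filterlim (\<lambda>n. wealth \<mu> Xs c n \<omega>) at_top sequentially"
    using wealth by blast
  \<comment> \<open>Any point strictly between 0 and \<open>c_max\<close> would do. Divergence at
    this single \<open>b\<close> controls the wealth for all \<open>c\<close> in
    \<open>{a..b}\<close>, so no uncountable union of null sets, one for each \<open>c\<close>,
    arises.\<close>
  define b where "b = c_max / 2"
  have b: "0 < b" "b < 1" "b < c_max" using c_max by (auto simp: b_def)
  obtain a where a: "0 < a" "a < b" "(LBINT c:{a..b}. \<pi> c) > 0"
    using near_0[OF b(1,2)] by blast
  have "AE \<omega> in P. \<forall>i\<ge>1. 0 \<le> Xs i \<omega>"
    using assms by (intro iid_sample_nonneg) auto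
  with lim[OF b(1,3)]
  show mixed: "AE \<omega> in P. filterlim (\<lambda>n. mixed_wealth \<mu> Xs \<pi> n \<omega>) at_top sequentially"
    by eventually_elim (rule mixed_wealth_at_top[OF assms(1) a(1,2) b(2) _ \<pi> a(3)])
  interpret prob_space P by fact
  fix \<alpha> :: real
  have "Xs i \<in> borel_measurable P" if "1 \<le> i" for i
    using assms(7) that by (auto simp: iid_sample_def indep_vars_def)
  then show "test_power P (mixed_wealth \<mu> Xs \<pi>) \<alpha> = 1"
    using \<pi> mixed by (intro test_power_eq_1 borel_measurable_mixed_wealth)
      (auto simp: unit_interval_density_def)
qed

end
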